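(* Let $R$ be a finite commutative local Frobenius ring with residue field $\mathbb{F}_q$. For $i=1,2$, let $C_i$ be a linear code of length $n$ over $R$ with generator matrix $\mathrm{G}_i$ and parity check matrix $\mathrm{H}_i$. Then $\dim(C_1\cap C_2)=\dim(C_1)-\texttt{Rank}_q(\mathrm{H}_2\mathrm{G}_1^\top)$ or $\dim(C_1\cap C_2)=\dim(C_2)-\texttt{Rank}_q(\mathrm{H}_1\mathrm{G}_2^\top)$.
   Context: A linear code of length $n$ over $R$ is an $R$-submodule of $R^n$; $\dim(C):=\log_q|C|$. A generator matrix of $C$ is a matrix whose rows generate $C$; a parity check matrix of $C$ is a generator matrix of $C^\perp=\{\mathbf{u}\in R^n:\sum_j u_jc_j=0\ \forall \mathbf{c}\in C\}$. For a matrix $\mathrm{A}$ over $R$, $\texttt{Rank}_q(\mathrm{A}):=\log_q|M|$ where $M$ is the $R$-submodule spanned by the rows of $\mathrm{A}$. *)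

theory Defs
  imports Complex_Main "Jordan_Normal_Form.Matrix"
begin

section \<open>Ideals of a commutative ring (type-class idiom, the ring is the type 'a)\<close>

definition is_ideal :: "'a::comm_ring_1 set \<Rightarrow> bool" where
  "is_ideal I \<longleftrightarrow> 0 \<in> I \<and> (\<forall>x\<in>I. \<forall>y\<in>I. x + y \<in> I) \<and> (\<forall>r. \<forall>x\<in>I. r * x \<in> I)"

definition maximal_ideal :: "'a::comm_ring_1 set \<Rightarrow> bool" where
  "maximal_ideal M \<longleftrightarrow> is_ideal M \<and> M \<noteq> UNIV \<and>
     (\<forall>J. is_ideal J \<and> M \<subseteq> J \<and> J \<noteq> UNIV \<longrightarrow> J = M)"

definition minimal_ideal :: "'a::comm_ring_1 set \<Rightarrow> bool" where
  "minimal_ideal I \<longleftrightarrow> is_ideal I \<and> I \<noteq> {0} \<and>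
     (\<forall>J. is_ideal J \<and> J \<subseteq> I \<and> J \<noteq> {0} \<longrightarrow> J = I)"

text \<open>Local ring: exactly one maximal ideal.\<close>
definition local_ring :: "'a::comm_ring_1 itself \<Rightarrow> bool" where
  "local_ring _ \<longleftrightarrow> (\<exists>!M::'a set. maximal_ideal M)"

text \<open>Frobenius (for a finite commutative local ring): the socle is simple
  (socle isomorphic to the residue field), i.e. there is exactly one minimal ideal.\<close>
definition frobenius_local_ring :: "'a::comm_ring_1 itself \<Rightarrow> bool" where
  "frobenius_local_ring _ \<longleftrightarrow> (\<exists>!I::'a set. minimal_ideal I)"

text \<open>The unique maximal ideal and the size of the residue field R/M.\<close>
definition the_maximal_ideal :: "'a::comm_ring_1 set" where
  "the_maximal_ideal = (THE M. maximal_ideal M)"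

definition residue_field_card :: "'a::comm_ring_1 itself \<Rightarrow> nat" where
  "residue_field_card _ = card {(\<lambda>m. x + m) ` (the_maximal_ideal :: 'a set) | x. True}"

section \<open>Linear codes\<close>

text \<open>Linear code of length n: an R-submodule of R^n.\<close>
definition linear_code :: "nat \<Rightarrow> 'a::comm_ring_1 vec set \<Rightarrow> bool" where
  "linear_code n C \<longleftrightarrow> C \<subseteq> carrier_vec n \<and> 0\<^sub>v n \<in> C \<and>
     (\<forall>x\<in>C. \<forall>y\<in>C. x + y \<in> C) \<and> (\<forall>r. \<forall>x\<in>C. r \<cdot>\<^sub>v x \<in> C)"

text \<open>R-submodule spanned by the rows of A: all R-linear combinations of the rows.\<close>
definition row_module :: "'a::comm_ring_1 mat \<Rightarrow> 'a vec set" where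
  "row_module A = {transpose_mat A *\<^sub>v c | c. c \<in> carrier_vec (dim_row A)}"

definition dual_code :: "nat \<Rightarrow> 'a::comm_ring_1 vec set \<Rightarrow> 'a vec set" where
  "dual_code n C = {u \<in> carrier_vec n. \<forall>c\<in>C. u \<bullet> c = 0}"

definition generator_matrix :: "nat \<Rightarrow> 'a::comm_ring_1 mat \<Rightarrow> 'a vec set \<Rightarrow> bool" where
  "generator_matrix n G C \<longleftrightarrow> dim_col G = n \<and> row_module G = C"

definition parity_check_matrix :: "nat \<Rightarrow> 'a::comm_ring_1 mat \<Rightarrow> 'a vec set \<Rightarrow> bool" where
  "parity_check_matrix n H C \<longleftrightarrow> generator_matrix n H (dual_code n C)"

text \<open>dim(C) = log_q |C|, Rank_q(A) = log_q |row module of A|.\<close>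
definition code_dim :: "nat \<Rightarrow> 'a vec set \<Rightarrow> real" where
  "code_dim q C = log (real q) (real (card C))"

definition rank_q :: "nat \<Rightarrow> 'a::comm_ring_1 mat \<Rightarrow> real" where
  "rank_q q A = log (real q) (real (card (row_module A)))"

end

theory Submission
  imports Defs "HOL-Computational_Algebra.Fundamental_Theorem_Algebra"
begin

text \<open>
  Over a finite ring with a unique minimal ideal there is a generating character \<chi>:
  an additive character that is nontrivial on the minimal ideal and hence on every nonzero ideal.
  It is built by extending, one cyclic subgroup at a time, a character that is nontrivial on a
  nonzero element of that ideal. Orthogonality of the sums \<open>\<Sum>\<^sub>c \<chi>(u \<bullet> c)\<close> then gives
  \<open>|C| |C\<^sup>\<bottom>| = |R\<^sup>n|\<close> and \<open>C\<^sup>\<bottom>\<^sup>\<bottom> = C\<close>. Consequently the map \<open>x \<mapsto> H\<^sub>2 x\<close> on \<open>C\<^sub>1\<close> has kernel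
  \<open>C\<^sub>1 \<inter> C\<^sub>2\<close>, and its image, the column space of \<open>H\<^sub>2 G\<^sub>1\<^sup>T\<close>, has the size of the row
  space of that matrix. Hence \<open>|C\<^sub>1| = |row space of H\<^sub>2 G\<^sub>1\<^sup>T| |C\<^sub>1 \<inter> C\<^sub>2|\<close>, and taking
  \<open>log\<^sub>q\<close> gives the first alternative.
\<close>

section \<open>Additive characters of a finite ring\<close>

definition additive_subgroup :: "'a::ab_group_add set \<Rightarrow> bool" where
  "additive_subgroup H \<longleftrightarrow> 0 \<in> H \<and> (\<forall>x\<in>H. \<forall>y\<in>H. x + y \<in> H) \<and> (\<forall>x\<in>H. - x \<in> H)"

definition character_on :: "'a::ab_group_add set \<Rightarrow> ('a \<Rightarrow> complex) \<Rightarrow> bool" where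
  "character_on H \<chi> \<longleftrightarrow> (\<forall>x\<in>H. \<forall>y\<in>H. \<chi> (x + y) = \<chi> x * \<chi> y) \<and> (\<forall>x\<in>H. \<chi> x \<noteq> 0)"

definition adjoin :: "'a::ring_1 set \<Rightarrow> 'a \<Rightarrow> 'a set" where
  "adjoin H g = {h + of_int k * g | h k. h \<in> H}"

definition relative_order :: "'a::ring_1 set \<Rightarrow> 'a \<Rightarrow> nat" where
  "relative_order H g = (LEAST m. 0 < m \<and> of_nat m * g \<in> H)"

lemma additive_subgroup_of_int_mult:
  fixes H :: "'a::ring_1 set"
  assumes H: "additive_subgroup H" and h: "h \<in> H"
  shows "of_int k * h \<in> H"
proof (induction k rule: int_induct[where k = 0])
  case (step2 i)
  have "of_int (i - 1) * h = of_int i * h + - h" by (simp add: algebra_simps)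
  also have "\<dots> \<in> H" using H h step2 unfolding additive_subgroup_def by blast
  finally show ?case .
qed (use H h in \<open>auto simp: additive_subgroup_def distrib_right\<close>)

lemma character_on_zero:
  assumes "additive_subgroup H" "character_on H \<chi>"
  shows "\<chi> 0 = 1"
proof -
  have "\<chi> 0 = \<chi> 0 * \<chi> 0" "\<chi> 0 \<noteq> 0"
    using assms unfolding additive_subgroup_def character_on_def by (metis add_0)+
  then show ?thesis by simp
qed

lemma character_on_of_int_mult:
  fixes H :: "'a::ring_1 set"
  assumes H: "additive_subgroup H" and \<chi>: "character_on H \<chi>" and h: "h \<in> H"
  shows "\<chi> (of_int k * h) = power_int (\<chi> h) k"
proof (induction k rule: int_induct[where k = 0])
  case base
  then show ?case using character_on_zero[OF H \<chi>] by simp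
next
  case (step1 i)
  have "\<chi> (of_int (i + 1) * h) = \<chi> (of_int i * h) * \<chi> h"
    using \<chi> h additive_subgroup_of_int_mult[OF H h] by (simp add: character_on_def distrib_right)
  then show ?case using step1 \<chi> h by (simp add: character_on_def power_int_add_1)
next
  case (step2 i)
  have "of_int i * h = of_int (i - 1) * h + h" by (simp add: algebra_simps)
  then have "\<chi> (of_int i * h) = \<chi> (of_int (i - 1) * h) * \<chi> h"
    using \<chi> h additive_subgroup_of_int_mult[OF H h] unfolding character_on_def by metis
  moreover have "\<chi> h \<noteq> 0" using \<chi> h by (simp add: character_on_def)
  ultimately show ?case using step2 by (simp add: power_int_diff field_simps)
qed

lemma additive_subgroup_adjoin:
  fixes H :: "'a::ring_1 set"
  assumes H: "additive_subgroup H"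
  shows "additive_subgroup (adjoin H g)" "H \<subseteq> adjoin H g" "g \<in> adjoin H g"
proof -
  have mem: "h + of_int k * g \<in> adjoin H g" if "h \<in> H" for h k
    using that unfolding adjoin_def by blast
  show "additive_subgroup (adjoin H g)"
    unfolding additive_subgroup_def
  proof (intro conjI ballI)
    show "0 \<in> adjoin H g" using mem[of 0 0] H by (simp add: additive_subgroup_def)
  next
    fix x y assume "x \<in> adjoin H g" "y \<in> adjoin H g"
    then obtain h1 k1 h2 k2 where "x = h1 + of_int k1 * g" "y = h2 + of_int k2 * g" "h1 \<in> H" "h2 \<in> H"
      unfolding adjoin_def by blast
    then show "x + y \<in> adjoin H g"
      using mem[of "h1 + h2" "k1 + k2"] H by (simp add: additive_subgroup_def algebra_simps)
  next
    fix x assume "x \<in> adjoin H g"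
    then obtain h k where "x = h + of_int k * g" "h \<in> H"
      unfolding adjoin_def by blast
    then show "- x \<in> adjoin H g"
      using mem[of "- h" "- k"] H by (simp add: additive_subgroup_def algebra_simps)
  qed
  show "H \<subseteq> adjoin H g" using mem[of _ 0] by auto
  show "g \<in> adjoin H g" using mem[of 0 1] H by (simp add: additive_subgroup_def)
qed

lemma relative_order:
  fixes g :: "'a::{ring_1,finite}"
  assumes H: "additive_subgroup H"
  shows "relative_order H g > 0" "of_nat (relative_order H g) * g \<in> H"
    and "of_int k * g \<in> H \<longleftrightarrow> int (relative_order H g) dvd k"
proof -
  let ?m = "relative_order H g"
  have "0 < CHAR('a) \<and> of_nat CHAR('a) * g \<in> H"
    using H finite_imp_CHAR_pos[where 'a = 'a] by (simp add: additive_subgroup_def)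
  then have m: "0 < ?m \<and> of_nat ?m * g \<in> H"
    unfolding relative_order_def by (rule LeastI)
  then show "?m > 0" "of_nat ?m * g \<in> H" by auto
  show "of_int k * g \<in> H \<longleftrightarrow> int ?m dvd k"
  proof
    assume k: "of_int k * g \<in> H"
    have "of_int (k mod int ?m) = (of_int k - of_int (k div int ?m) * of_nat ?m :: 'a)"
      by (simp add: minus_div_mult_eq_mod[symmetric])
    then have "of_int (k mod int ?m) * g
        = of_int k * g + - (of_int (k div int ?m) * (of_nat ?m * g))"
      by (simp add: left_diff_distrib mult.assoc)
    also have "\<dots> \<in> H"
      using H k additive_subgroup_of_int_mult[OF H] m unfolding additive_subgroup_def by blast
    finally have "of_nat (nat (k mod int ?m)) * g \<in> H" using m by simp
    moreover have "nat (k mod int ?m) < ?m" using m by (simp add: nat_less_iff)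
    ultimately have "\<not> 0 < nat (k mod int ?m)"
      using not_less_Least[of "nat (k mod int ?m)" "\<lambda>j. 0 < j \<and> of_nat j * g \<in> H"]
      unfolding relative_order_def by auto
    moreover have "0 \<le> k mod int ?m" using m by simp
    ultimately show "int ?m dvd k" by (simp add: dvd_eq_mod_eq_0)
  next
    assume "int ?m dvd k"
    then obtain t where "k = int ?m * t" by (elim dvdE)
    then have "of_int k * g = of_int t * (of_nat ?m * g)" by (simp add: algebra_simps)
    then show "of_int k * g \<in> H" using additive_subgroup_of_int_mult[OF H] m by simp
  qed
qed

lemma character_on_adjoin_well_defined:
  fixes H :: "'a::{ring_1,finite} set"
  assumes H: "additive_subgroup H" and \<chi>: "character_on H \<chi>"
    and z: "z ^ relative_order H g = \<chi> (of_nat (relative_order H g) * g)"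
    and hh': "h \<in> H" "h' \<in> H" and eq: "h + of_int k * g = h' + of_int k' * g"
  shows "\<chi> h * power_int z k = \<chi> h' * power_int z k'"
proof -
  let ?m = "relative_order H g"
  have mg: "of_nat ?m * g \<in> H" using relative_order(2)[OF H] .
  have "of_int (k - k') * g = h' + - h" using eq by (simp add: algebra_simps)
  also have "\<dots> \<in> H" using H hh' unfolding additive_subgroup_def by blast
  finally obtain t where t: "k - k' = int ?m * t" using relative_order(3)[OF H] by (meson dvdE)
  have "of_int (k - k') * g = of_int t * (of_nat ?m * g)"
    unfolding t by (simp only: mult.commute[of "int ?m"] of_int_mult of_int_of_nat_eq mult.assoc)
  then have h': "h' = h + of_int t * (of_nat ?m * g)" using eq by (simp add: algebra_simps)
  have "\<chi> (of_nat ?m * g) \<noteq> 0" using \<chi> mg unfolding character_on_def by blast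
  then have "z \<noteq> 0" using z relative_order(1)[OF H, of g] by (metis zero_power)
  have "\<chi> h' = \<chi> h * power_int (\<chi> (of_nat ?m * g)) t"
    unfolding h' using \<chi> hh'(1) additive_subgroup_of_int_mult[OF H mg]
      character_on_of_int_mult[OF H \<chi> mg] unfolding character_on_def by simp
  also have "\<dots> = \<chi> h * power_int z (k - k')"
    unfolding t z[symmetric] by (simp add: power_int_mult)
  finally show ?thesis using \<open>z \<noteq> 0\<close> by (simp add: power_int_diff)
qed

lemma character_on_adjoin:
  fixes H :: "'a::{ring_1,finite} set"
  assumes H: "additive_subgroup H" and \<chi>: "character_on H \<chi>"
    and z: "z ^ relative_order H g = \<chi> (of_nat (relative_order H g) * g)"
  obtains \<chi>' where "character_on (adjoin H g) \<chi>'" "\<And>h. h \<in> H \<Longrightarrow> \<chi>' h = \<chi> h" "\<chi>' g = z"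
proof -
  have "\<chi> (of_nat (relative_order H g) * g) \<noteq> 0"
    using \<chi> relative_order(2)[OF H] unfolding character_on_def by blast
  then have "z \<noteq> 0" using z relative_order(1)[OF H, of g] by (metis zero_power)
  define rep where "rep x = (SOME p. fst p \<in> H \<and> x = fst p + of_int (snd p) * g)" for x
  define \<chi>' where "\<chi>' x = \<chi> (fst (rep x)) * power_int z (snd (rep x))" for x
  have \<chi>'_eq: "\<chi>' (h + of_int k * g) = \<chi> h * power_int z k" if "h \<in> H" for h k
  proof -
    let ?x = "h + of_int k * g"
    have "\<exists>p. fst p \<in> H \<and> ?x = fst p + of_int (snd p) * g" using that by force
    then have "fst (rep ?x) \<in> H \<and> ?x = fst (rep ?x) + of_int (snd (rep ?x)) * g"
      unfolding rep_def by (rule someI_ex)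
    then have "fst (rep ?x) \<in> H" "?x = fst (rep ?x) + of_int (snd (rep ?x)) * g" by auto
    then show ?thesis
      unfolding \<chi>'_def using character_on_adjoin_well_defined[OF H \<chi> z that] by simp
  qed
  have "character_on (adjoin H g) \<chi>'"
    unfolding character_on_def
  proof (intro conjI ballI)
    fix x y assume "x \<in> adjoin H g" "y \<in> adjoin H g"
    then obtain h1 k1 h2 k2 where xy: "x = h1 + of_int k1 * g" "y = h2 + of_int k2 * g" "h1 \<in> H" "h2 \<in> H"
      unfolding adjoin_def by blast
    have "x + y = (h1 + h2) + of_int (k1 + k2) * g" using xy by (simp add: algebra_simps)
    moreover have "h1 + h2 \<in> H" using H xy unfolding additive_subgroup_def by blast
    ultimately have "\<chi>' (x + y) = \<chi> (h1 + h2) * power_int z (k1 + k2)"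
      by (simp only: \<chi>'_eq)
    also have "\<dots> = \<chi>' x * \<chi>' y"
      using \<chi> xy \<open>z \<noteq> 0\<close> \<chi>'_eq by (simp add: character_on_def power_int_add)
    finally show "\<chi>' (x + y) = \<chi>' x * \<chi>' y" .
  next
    fix x assume "x \<in> adjoin H g"
    then obtain h k where "x = h + of_int k * g" "h \<in> H" unfolding adjoin_def by blast
    then show "\<chi>' x \<noteq> 0" using \<chi> \<open>z \<noteq> 0\<close> \<chi>'_eq by (simp add: character_on_def)
  qed
  moreover have "\<chi>' h = \<chi> h" if "h \<in> H" for h using \<chi>'_eq[OF that, of 0] by simp
  moreover have "\<chi>' g = z"
    using \<chi>'_eq[of 0 1] H character_on_zero[OF H \<chi>] by (simp add: additive_subgroup_def)
  ultimately show ?thesis using that by blast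
qed

lemma character_on_extend_UNIV:
  fixes H :: "'a::{ring_1,finite} set"
  assumes H: "additive_subgroup H" and \<chi>: "character_on H \<chi>"
  obtains \<chi>' where "character_on UNIV \<chi>'" "\<And>h. h \<in> H \<Longrightarrow> \<chi>' h = \<chi> h"
proof -
  have "\<exists>H' \<chi>'. additive_subgroup H' \<and> H \<union> X \<subseteq> H' \<and> character_on H' \<chi>' \<and> (\<forall>h\<in>H. \<chi>' h = \<chi> h)"
    if "finite X" for X :: "'a set"
    using that
  proof (induction X rule: finite_induct)
    case empty
    show ?case using H \<chi> by auto
  next
    case (insert x X)
    then obtain H' \<chi>' where IH: "additive_subgroup H'" "H \<union> X \<subseteq> H'" "character_on H' \<chi>'"
        "\<forall>h\<in>H. \<chi>' h = \<chi> h"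
      by blast
    obtain w where "w ^ relative_order H' x = \<chi>' (of_nat (relative_order H' x) * x)"
      using nth_root_exists[OF relative_order(1)[OF IH(1)]] by blast
    then obtain \<chi>'' where \<chi>'': "character_on (adjoin H' x) \<chi>''" "\<forall>h\<in>H'. \<chi>'' h = \<chi>' h"
      using character_on_adjoin[OF IH(1,3)] by metis
    show ?case
      by (intro exI[of _ "adjoin H' x"] exI[of _ \<chi>''])
        (use additive_subgroup_adjoin[OF IH(1), of x] IH \<chi>'' in auto)
  qed
  from this[OF finite_UNIV] obtain H' \<chi>'
    where "UNIV \<subseteq> H'" "character_on H' \<chi>'" "\<forall>h\<in>H. \<chi>' h = \<chi> h"
    by auto
  then show ?thesis using that by (auto simp: top.extremum_unique)
qed

lemma separating_character:
  fixes s :: "'a::{ring_1,finite}"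
  assumes "s \<noteq> 0"
  obtains \<chi> where "character_on UNIV \<chi>" "\<chi> s \<noteq> 1"
proof -
  have H0: "additive_subgroup {0::'a}" and \<chi>0: "character_on {0::'a} (\<lambda>_. 1)"
    by (simp_all add: additive_subgroup_def character_on_def)
  let ?m = "relative_order {0} s"
  txt \<open>The order of \<open>s\<close> is at least 2, so \<open>s\<close> may be sent to an \<open>m\<close>-th root of unity \<open>z \<noteq> 1\<close>.\<close>
  have "\<not> int ?m dvd 1" using relative_order(3)[OF H0, of 1] assms by simp
  then have "card {z::complex. z ^ ?m = 1} \<noteq> 1"
    using card_roots_unity_eq[OF relative_order(1)[OF H0]] by auto
  then have "{z::complex. z ^ ?m = 1} \<noteq> {1}" by auto
  then obtain z :: complex where z: "z ^ ?m = 1" "z \<noteq> 1" by auto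
  then obtain \<chi>1 where \<chi>1: "character_on (adjoin {0} s) \<chi>1" "\<chi>1 s = z"
    using character_on_adjoin[OF H0 \<chi>0, of z s] by auto
  obtain \<chi> where \<chi>: "character_on UNIV \<chi>" "\<forall>h\<in>adjoin {0} s. \<chi> h = \<chi>1 h"
    using character_on_extend_UNIV[OF additive_subgroup_adjoin(1)[OF H0] \<chi>1(1)] by metis
  then have "\<chi> s = z" using additive_subgroup_adjoin(3)[OF H0, of s] \<chi>1(2) by simp
  then show ?thesis using that \<chi>(1) z(2) by blast
qed

definition generating_character :: "('a::comm_ring_1 \<Rightarrow> complex) \<Rightarrow> bool" where
  "generating_character \<chi> \<longleftrightarrow>
     character_on UNIV \<chi> \<and> (\<forall>I. is_ideal I \<and> I \<noteq> {0} \<longrightarrow> (\<exists>x\<in>I. \<chi> x \<noteq> 1))"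

lemma ideal_contains_minimal_ideal:
  fixes I :: "'a::{comm_ring_1,finite} set"
  assumes "is_ideal I" "I \<noteq> {0}"
  obtains J where "minimal_ideal J" "J \<subseteq> I"
proof -
  let ?P = "\<lambda>J. is_ideal J \<and> J \<subseteq> I \<and> J \<noteq> {0}"
  obtain J where J: "?P J" "\<And>J'. ?P J' \<Longrightarrow> card J \<le> card J'"
    using ex_has_least_nat[of ?P I card] assms by blast
  have "minimal_ideal J"
    unfolding minimal_ideal_def
  proof (intro conjI allI impI)
    fix J' assume J': "is_ideal J' \<and> J' \<subseteq> J \<and> J' \<noteq> {0}"
    then have "card J \<le> card J'" using J by blast
    then show "J' = J" using J' card_seteq[OF finite, of J' J] by blast
  qed (use J in auto)
  then show ?thesis using J that by blast
qed

lemma frobenius_local_ring_generating_character: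
  assumes "frobenius_local_ring TYPE('a::{comm_ring_1,finite})"
  obtains \<chi> :: "'a::{comm_ring_1,finite} \<Rightarrow> complex" where "generating_character \<chi>"
proof -
  obtain S :: "'a set" where S: "minimal_ideal S" "\<And>J. minimal_ideal J \<Longrightarrow> J = S"
    using assms unfolding frobenius_local_ring_def by blast
  obtain s where s: "s \<in> S" "s \<noteq> 0" using S(1) unfolding minimal_ideal_def is_ideal_def by auto
  obtain \<chi> where \<chi>: "character_on UNIV \<chi>" "\<chi> s \<noteq> 1" using separating_character[OF s(2)] by blast
  have "\<exists>x\<in>I. \<chi> x \<noteq> 1" if I: "is_ideal I" "I \<noteq> {0}" for I
  proof -
    obtain J where "minimal_ideal J" "J \<subseteq> I" using ideal_contains_minimal_ideal[OF I] .
    then have "s \<in> I" using S(2) s(1) by blast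
    then show ?thesis using \<chi>(2) by blast
  qed
  then show ?thesis using that \<chi>(1) by (auto simp: generating_character_def)
qed

section \<open>Character sums and the dual code\<close>

lemma finite_carrier_vec: "finite (carrier_vec n :: 'a::finite vec set)"
proof -
  have "carrier_vec n \<subseteq> vec_of_list ` {xs :: 'a list. set xs \<subseteq> UNIV \<and> length xs = n}"
  proof
    fix v :: "'a vec" assume "v \<in> carrier_vec n"
    then show "v \<in> vec_of_list ` {xs. set xs \<subseteq> UNIV \<and> length xs = n}"
      using vec_list[of v] by (intro image_eqI[of v _ "list_of_vec v"]) auto
  qed
  then show ?thesis
    by (rule finite_subset) (intro finite_imageI finite_lists_length_eq finite_UNIV)
qed

lemma finite_linear_code:
  fixes C :: "'a::{comm_ring_1,finite} vec set"
  shows "linear_code n C \<Longrightarrow> finite C"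
  using finite_subset[OF _ finite_carrier_vec] unfolding linear_code_def by blast

lemma card_linear_code_pos:
  fixes C :: "'a::{comm_ring_1,finite} vec set"
  shows "linear_code n C \<Longrightarrow> card C > 0"
  using finite_linear_code card_gt_0_iff unfolding linear_code_def by blast

lemma linear_code_carrier_vec: "linear_code n (carrier_vec n :: 'a::comm_ring_1 vec set)"
  unfolding linear_code_def by simp

lemma bij_betw_translate_linear_code:
  fixes C :: "'a::comm_ring_1 vec set"
  assumes "linear_code n C" "a \<in> C"
  shows "bij_betw ((+) a) C C"
proof (rule bij_betwI[where g = "\<lambda>x. (-1) \<cdot>\<^sub>v a + x"])
  have carrier: "C \<subseteq> carrier_vec n" and a: "a \<in> carrier_vec n"
    using assms unfolding linear_code_def by auto
  show "(+) a \<in> C \<rightarrow> C" "(\<lambda>x. (-1) \<cdot>\<^sub>v a + x) \<in> C \<rightarrow> C"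
    using assms unfolding linear_code_def by auto
  show "(-1) \<cdot>\<^sub>v a + (a + x) = x" "a + ((-1) \<cdot>\<^sub>v a + x) = x" if "x \<in> C" for x
    using that carrier a by (auto intro!: eq_vecI)
qed

lemma is_ideal_image_linear_code:
  fixes D :: "'a::comm_ring_1 vec set"
  assumes D: "linear_code n D"
    and f_add: "\<And>x y. x \<in> D \<Longrightarrow> y \<in> D \<Longrightarrow> f (x + y) = f x + f y"
    and f_smult: "\<And>r x. x \<in> D \<Longrightarrow> f (r \<cdot>\<^sub>v x) = r * f x"
  shows "is_ideal (f ` D)"
  unfolding is_ideal_def
proof (intro conjI ballI allI)
  have "0\<^sub>v n \<in> D" "0 \<cdot>\<^sub>v 0\<^sub>v n \<in> D" using D unfolding linear_code_def by auto
  then show "0 \<in> f ` D" using f_smult[of "0\<^sub>v n" 0] by (metis image_eqI mult_zero_left)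
next
  fix x y assume "x \<in> f ` D" "y \<in> f ` D"
  then obtain a b where "a \<in> D" "b \<in> D" "x = f a" "y = f b" by blast
  then have "x + y = f (a + b)" "a + b \<in> D" using D f_add unfolding linear_code_def by auto
  then show "x + y \<in> f ` D" by blast
next
  fix r x assume "x \<in> f ` D"
  then obtain a where "a \<in> D" "x = f a" by blast
  then have "r * x = f (r \<cdot>\<^sub>v a)" "r \<cdot>\<^sub>v a \<in> D" using D f_smult unfolding linear_code_def by auto
  then show "r * x \<in> f ` D" by blast
qed

lemma character_sum_linear_code:
  fixes \<chi> :: "'a::{comm_ring_1,finite} \<Rightarrow> complex"
  assumes \<chi>: "generating_character \<chi>" and D: "linear_code n D"
    and f_add: "\<And>x y. x \<in> D \<Longrightarrow> y \<in> D \<Longrightarrow> f (x + y) = f x + f y"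
    and f_smult: "\<And>r x. x \<in> D \<Longrightarrow> f (r \<cdot>\<^sub>v x) = r * f x"
  shows "(\<Sum>x\<in>D. \<chi> (f x)) = (if \<forall>x\<in>D. f x = 0 then of_nat (card D) else 0)"
proof (cases "\<forall>x\<in>D. f x = 0")
  case True
  have "\<chi> 0 = 1"
    using \<chi> character_on_zero[of UNIV \<chi>] by (simp add: generating_character_def additive_subgroup_def)
  then show ?thesis using True by simp
next
  case False
  then have "f ` D \<noteq> {0}" by auto
  then obtain a where a: "a \<in> D" "\<chi> (f a) \<noteq> 1"
    using \<chi> is_ideal_image_linear_code[OF D f_add f_smult] unfolding generating_character_def by blast
  txt \<open>Translating by \<open>a\<close> permutes \<open>D\<close> and multiplies the sum by \<open>\<chi> (f a) \<noteq> 1\<close>.\<close>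
  have "(\<Sum>x\<in>D. \<chi> (f x)) = (\<Sum>x\<in>D. \<chi> (f (a + x)))"
    by (rule sum.reindex_bij_betw[OF bij_betw_translate_linear_code[OF D a(1)], symmetric])
  also have "\<dots> = \<chi> (f a) * (\<Sum>x\<in>D. \<chi> (f x))"
    using \<chi> a(1) f_add by (simp add: generating_character_def character_on_def sum_distrib_left)
  finally have "(1 - \<chi> (f a)) * (\<Sum>x\<in>D. \<chi> (f x)) = 0" by (simp add: algebra_simps)
  then show ?thesis using False a(2) by auto
qed

lemma eq_zero_vec_if_orthogonal:
  fixes v :: "'a::comm_ring_1 vec"
  assumes v: "v \<in> carrier_vec n" and orth: "\<And>u. u \<in> carrier_vec n \<Longrightarrow> u \<bullet> v = 0"
  shows "v = 0\<^sub>v n"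
proof (rule eq_vecI)
  fix i assume "i < dim_vec (0\<^sub>v n :: 'a vec)"
  then have "v $ i = unit_vec n i \<bullet> v" using v by simp
  then show "v $ i = 0\<^sub>v n $ i" using orth[of "unit_vec n i"] \<open>i < dim_vec (0\<^sub>v n)\<close> by simp
qed (use v in simp)

lemma card_mult_card_dual_code:
  fixes C :: "'a::{comm_ring_1,finite} vec set" and \<chi> :: "'a \<Rightarrow> complex"
  assumes \<chi>: "generating_character \<chi>" and C: "linear_code n C"
  shows "card C * card (dual_code n C) = card (carrier_vec n :: 'a vec set)"
proof -
  let ?N = "carrier_vec n :: 'a vec set"
  have C_sub: "C \<subseteq> ?N" and C0: "0\<^sub>v n \<in> C" using C unfolding linear_code_def by auto
  have inner: "(\<Sum>c\<in>C. \<chi> (u \<bullet> c)) = (if u \<in> dual_code n C then of_nat (card C) else 0)"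
    if "u \<in> ?N" for u
    using character_sum_linear_code[OF \<chi> C, where f = "\<lambda>c. u \<bullet> c"] that C_sub
    by (auto simp: dual_code_def scalar_prod_add_distrib[of _ n] subset_iff)
  have outer: "(\<Sum>u\<in>?N. \<chi> (u \<bullet> c)) = (if c = 0\<^sub>v n then of_nat (card ?N) else 0)"
    if "c \<in> C" for c
  proof -
    have "c \<in> ?N" using that C_sub by blast
    then have "(\<forall>u\<in>?N. u \<bullet> c = 0) \<longleftrightarrow> c = 0\<^sub>v n" using eq_zero_vec_if_orthogonal by auto
    then show ?thesis
      using character_sum_linear_code[OF \<chi> linear_code_carrier_vec, where f = "\<lambda>u. u \<bullet> c"] \<open>c \<in> ?N\<close>
      by (simp add: add_scalar_prod_distrib[of _ n])
  qed
  have dual: "{u \<in> ?N. u \<in> dual_code n C} = dual_code n C" unfolding dual_code_def by blast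
  have "of_nat (card (dual_code n C) * card C) = (\<Sum>u\<in>dual_code n C. of_nat (card C) :: complex)"
    by simp
  also have "\<dots> = (\<Sum>u\<in>?N. if u \<in> dual_code n C then of_nat (card C) else 0)"
    by (subst sum.inter_filter[OF finite_carrier_vec, symmetric]) (simp only: dual)
  also have "\<dots> = (\<Sum>u\<in>?N. \<Sum>c\<in>C. \<chi> (u \<bullet> c))" by (simp add: inner)
  also have "\<dots> = (\<Sum>c\<in>C. \<Sum>u\<in>?N. \<chi> (u \<bullet> c))" by (rule sum.swap)
  also have "\<dots> = of_nat (card ?N)" using outer C0 finite_linear_code[OF C] by (simp add: sum.delta')
  finally show ?thesis by (simp only: of_nat_eq_iff mult.commute)
qed

lemma linear_code_dual_code:
  fixes C :: "'a::comm_ring_1 vec set"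
  assumes "C \<subseteq> carrier_vec n"
  shows "linear_code n (dual_code n C)"
  using assms unfolding linear_code_def dual_code_def
  by (auto simp: add_scalar_prod_distrib[of _ n] subset_iff)

lemma dual_code_dual_code:
  fixes C :: "'a::{comm_ring_1,finite} vec set" and \<chi> :: "'a \<Rightarrow> complex"
  assumes \<chi>: "generating_character \<chi>" and C: "linear_code n C"
  shows "dual_code n (dual_code n C) = C"
proof -
  have C_sub: "C \<subseteq> carrier_vec n" using C unfolding linear_code_def by blast
  have dual: "linear_code n (dual_code n C)" using linear_code_dual_code[OF C_sub] .
  have "C \<subseteq> dual_code n (dual_code n C)"
    using C_sub by (auto simp: dual_code_def comm_scalar_prod[of _ n] subset_iff)
  moreover have "card (dual_code n (dual_code n C)) = card C"
    using card_mult_card_dual_code[OF \<chi> C] card_mult_card_dual_code[OF \<chi> dual]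
      card_linear_code_pos[OF dual] by (metis mult.commute mult_left_cancel not_less0)
  ultimately show ?thesis
    using card_subset_eq[OF finite_linear_code[OF linear_code_dual_code]] dual
    unfolding linear_code_def by metis
qed

section \<open>Counting with matrices\<close>

lemma mult_mat_vec_smult:
  fixes A :: "'a::comm_ring_1 mat"
  assumes "A \<in> carrier_mat nr nc" "v \<in> carrier_vec nc"
  shows "A *\<^sub>v (k \<cdot>\<^sub>v v) = k \<cdot>\<^sub>v (A *\<^sub>v v)"
  using assms by (intro eq_vecI) (auto simp: scalar_prod_smult_distrib[of _ nc])

lemma linear_code_image_mult_mat_vec:
  fixes A :: "'a::comm_ring_1 mat"
  assumes A: "A \<in> carrier_mat nr nc"
  shows "linear_code nr ((*\<^sub>v) A ` carrier_vec nc)"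
  unfolding linear_code_def
proof (intro conjI ballI allI)
  have "A *\<^sub>v 0\<^sub>v nc = 0\<^sub>v nr" using A by (intro eq_vecI) auto
  then show "0\<^sub>v nr \<in> (*\<^sub>v) A ` carrier_vec nc" by (metis zero_carrier_vec image_eqI)
next
  fix x y assume "x \<in> (*\<^sub>v) A ` carrier_vec nc" "y \<in> (*\<^sub>v) A ` carrier_vec nc"
  then show "x + y \<in> (*\<^sub>v) A ` carrier_vec nc"
    using A mult_add_distrib_mat_vec[OF A] by (auto intro!: image_eqI[OF sym])
next
  fix k x assume "x \<in> (*\<^sub>v) A ` carrier_vec nc"
  then show "k \<cdot>\<^sub>v x \<in> (*\<^sub>v) A ` carrier_vec nc"
    using mult_mat_vec_smult[OF A] by (auto intro!: image_eqI[OF sym])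
qed (use A in auto)

lemma row_module_eq_image: "row_module A = (*\<^sub>v) (transpose_mat A) ` carrier_vec (dim_row A)"
  unfolding row_module_def by blast

lemma linear_code_row_module: "linear_code (dim_col A) (row_module A)"
  unfolding row_module_eq_image by (rule linear_code_image_mult_mat_vec) simp

lemma dual_code_row_module:
  fixes A :: "'a::comm_ring_1 mat"
  assumes A: "A \<in> carrier_mat nr nc"
  shows "dual_code nc (row_module A) = {x \<in> carrier_vec nc. A *\<^sub>v x = 0\<^sub>v nr}"
proof -
  have "x \<bullet> (transpose_mat A *\<^sub>v y) = y \<bullet> (A *\<^sub>v x)"
    if "x \<in> carrier_vec nc" "y \<in> carrier_vec nr" for x y
    using that A transpose_vec_mult_scalar[OF A] comm_scalar_prod[of x nc] by simp
  then show ?thesis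
    using A eq_zero_vec_if_orthogonal[of "A *\<^sub>v _" nr]
    unfolding dual_code_def row_module_eq_image by auto
qed

lemma card_eq_card_image_mult_card_fiber:
  assumes "finite D" "\<And>a. a \<in> D \<Longrightarrow> card {x \<in> D. f x = f a} = k"
  shows "card D = card (f ` D) * k"
proof -
  have "card D = card (\<Union>y\<in>f ` D. {x \<in> D. f x = y})" by (rule arg_cong[where f = card]) blast
  also have "\<dots> = (\<Sum>y\<in>f ` D. card {x \<in> D. f x = y})"
    by (rule card_UN_disjoint) (use assms(1) in auto)
  also have "\<dots> = (\<Sum>y\<in>f ` D. k)" by (rule sum.cong) (use assms(2) in auto)
  finally show ?thesis by simp
qed

lemma fiber_mult_mat_vec_linear_code:
  fixes D :: "'a::comm_ring_1 vec set"
  assumes A: "A \<in> carrier_mat nr nc" and D: "linear_code nc D" and a: "a \<in> D"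
  shows "{x \<in> D. A *\<^sub>v x = A *\<^sub>v a} = (+) a ` {x \<in> D. A *\<^sub>v x = 0\<^sub>v nr}"
proof -
  have carrier: "D \<subseteq> carrier_vec nc" using D unfolding linear_code_def by blast
  have "A *\<^sub>v a \<in> carrier_vec nr" using A a carrier by auto
  then have inj: "inj_on ((+) (A *\<^sub>v a)) (carrier_vec nr)"
    using bij_betw_translate_linear_code[OF linear_code_carrier_vec] bij_betw_imp_inj_on by blast
  have kernel: "A *\<^sub>v (a + k) = A *\<^sub>v a \<longleftrightarrow> A *\<^sub>v k = 0\<^sub>v nr" if "k \<in> D" for k
  proof -
    have k: "k \<in> carrier_vec nc" using that carrier by blast
    then have "A *\<^sub>v (a + k) = A *\<^sub>v a \<longleftrightarrow> A *\<^sub>v a + A *\<^sub>v k = A *\<^sub>v a + 0\<^sub>v nr"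
      using mult_add_distrib_mat_vec[OF A] a carrier A by auto
    also have "\<dots> \<longleftrightarrow> A *\<^sub>v k = 0\<^sub>v nr" by (rule inj_on_eq_iff[OF inj]) (use A k in auto)
    finally show ?thesis .
  qed
  have translate: "(+) a ` D = D" using bij_betw_translate_linear_code[OF D a] by (simp add: bij_betw_def)
  show ?thesis
  proof
    show "{x \<in> D. A *\<^sub>v x = A *\<^sub>v a} \<subseteq> (+) a ` {x \<in> D. A *\<^sub>v x = 0\<^sub>v nr}"
    proof clarify
      fix x assume x: "x \<in> D" "A *\<^sub>v x = A *\<^sub>v a"
      then obtain k where "k \<in> D" "x = a + k" using translate by blast
      then show "x \<in> (+) a ` {x \<in> D. A *\<^sub>v x = 0\<^sub>v nr}" using kernel x by auto
    qed
    show "(+) a ` {x \<in> D. A *\<^sub>v x = 0\<^sub>v nr} \<subseteq> {x \<in> D. A *\<^sub>v x = A *\<^sub>v a}"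
      using kernel translate by auto
  qed
qed

lemma card_linear_code_eq_card_image_mult_card_kernel:
  fixes D :: "'a::{comm_ring_1,finite} vec set"
  assumes A: "A \<in> carrier_mat nr nc" and D: "linear_code nc D"
  shows "card D = card ((*\<^sub>v) A ` D) * card {x \<in> D. A *\<^sub>v x = 0\<^sub>v nr}"
proof (rule card_eq_card_image_mult_card_fiber[OF finite_linear_code[OF D]])
  fix a assume a: "a \<in> D"
  have "inj_on ((+) a) {x \<in> D. A *\<^sub>v x = 0\<^sub>v nr}"
    using bij_betw_imp_inj_on[OF bij_betw_translate_linear_code[OF D a]] by (rule inj_on_subset) auto
  then show "card {x \<in> D. A *\<^sub>v x = A *\<^sub>v a} = card {x \<in> D. A *\<^sub>v x = 0\<^sub>v nr}"
    unfolding fiber_mult_mat_vec_linear_code[OF A D a] by (rule card_image)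
qed

lemma card_image_mult_mat_vec_eq_card_row_module:
  fixes A :: "'a::{comm_ring_1,finite} mat" and \<chi> :: "'a \<Rightarrow> complex"
  assumes \<chi>: "generating_character \<chi>" and A: "A \<in> carrier_mat nr nc"
  shows "card ((*\<^sub>v) A ` carrier_vec nc) = card (row_module A)"
proof -
  let ?K = "dual_code nc (row_module A)"
  have R: "linear_code nc (row_module A)" using linear_code_row_module[of A] A by simp
  have "card ((*\<^sub>v) A ` carrier_vec nc) * card ?K = card (carrier_vec nc :: 'a vec set)"
    using card_linear_code_eq_card_image_mult_card_kernel[OF A linear_code_carrier_vec]
      dual_code_row_module[OF A] by simp
  also have "\<dots> = card (row_module A) * card ?K" using card_mult_card_dual_code[OF \<chi> R] by simp
  finally show ?thesis
    using card_linear_code_pos[OF linear_code_dual_code[of "row_module A" nc]] R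
    unfolding linear_code_def by simp
qed

lemma card_code_eq_card_row_module_mult_card_Int:
  fixes C1 C2 :: "'a::{comm_ring_1,finite} vec set" and \<chi> :: "'a \<Rightarrow> complex"
  assumes \<chi>: "generating_character \<chi>" and C2: "linear_code n C2"
    and G1: "generator_matrix n G1 C1" and H2: "parity_check_matrix n H2 C2"
  shows "card C1 = card (row_module (H2 * transpose_mat G1)) * card (C1 \<inter> C2)"
proof -
  let ?k = "dim_row G1" and ?r = "dim_row H2"
  have G1_carrier: "transpose_mat G1 \<in> carrier_mat n ?k" and C1_eq: "C1 = row_module G1"
    and H2_carrier: "H2 \<in> carrier_mat ?r n" and H2_rows: "row_module H2 = dual_code n C2"
    using G1 H2 unfolding parity_check_matrix_def generator_matrix_def by auto
  have C1: "linear_code n C1"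
    using linear_code_row_module[of G1] G1 unfolding generator_matrix_def by simp
  have "C2 = dual_code n (row_module H2)" using dual_code_dual_code[OF \<chi> C2] H2_rows by simp
  also have "\<dots> = {x \<in> carrier_vec n. H2 *\<^sub>v x = 0\<^sub>v ?r}" by (rule dual_code_row_module[OF H2_carrier])
  finally have C2_eq: "C2 = {x \<in> carrier_vec n. H2 *\<^sub>v x = 0\<^sub>v ?r}" .
  have "C1 \<subseteq> carrier_vec n" using C1 unfolding linear_code_def by blast
  then have "{x \<in> C1. H2 *\<^sub>v x = 0\<^sub>v ?r} = C1 \<inter> C2" unfolding C2_eq by blast
  then have "card C1 = card ((*\<^sub>v) H2 ` C1) * card (C1 \<inter> C2)"
    using card_linear_code_eq_card_image_mult_card_kernel[OF H2_carrier C1] by simp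
  moreover have "(*\<^sub>v) H2 ` C1 = (*\<^sub>v) (H2 * transpose_mat G1) ` carrier_vec ?k"
    unfolding C1_eq row_module_eq_image image_image
    by (intro image_cong refl assoc_mult_mat_vec[symmetric, OF H2_carrier G1_carrier])
  moreover have "card ((*\<^sub>v) (H2 * transpose_mat G1) ` carrier_vec ?k)
      = card (row_module (H2 * transpose_mat G1))"
    using card_image_mult_mat_vec_eq_card_row_module[OF \<chi> mult_carrier_mat[OF H2_carrier G1_carrier]] .
  ultimately show ?thesis by simp
qed

theorem lemma3p9:
  fixes C1 C2 :: "'a::{comm_ring_1,finite} vec set"
    and G1 G2 H1 H2 :: "'a mat"
    and n q :: nat
  assumes "local_ring TYPE('a)"
    and "frobenius_local_ring TYPE('a)"
    and "residue_field_card TYPE('a) = q"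
    and "linear_code n C1" and "linear_code n C2"
    and "generator_matrix n G1 C1" and "generator_matrix n G2 C2"
    and "parity_check_matrix n H1 C1" and "parity_check_matrix n H2 C2"
  shows "code_dim q (C1 \<inter> C2) = code_dim q C1 - rank_q q (H2 * transpose_mat G1)
       \<or> code_dim q (C1 \<inter> C2) = code_dim q C2 - rank_q q (H1 * transpose_mat G2)"
proof (rule disjI1)
  txt \<open>The first alternative always holds.\<close>
  obtain \<chi> :: "'a \<Rightarrow> complex" where \<chi>: "generating_character \<chi>"
    using frobenius_local_ring_generating_character[OF assms(2)] by blast
  have count: "card C1 = card (row_module (H2 * transpose_mat G1)) * card (C1 \<inter> C2)"
    using card_code_eq_card_row_module_mult_card_Int[OF \<chi> assms(5,6,9)] .
  then have "card (row_module (H2 * transpose_mat G1)) \<noteq> 0" "card (C1 \<inter> C2) \<noteq> 0"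
    using card_linear_code_pos[OF assms(4)] by auto
  then show "code_dim q (C1 \<inter> C2) = code_dim q C1 - rank_q q (H2 * transpose_mat G1)"
    unfolding code_dim_def rank_q_def count by (simp add: log_mult)
qed

end
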